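(* Let $a_1,a_2\in\mathbb{R}$, $\alpha_1,\alpha_2>0$, $\kappa_1\ge 0$, $\kappa_2>0$, and let $Z_t=(X_t,Y_t)$ be the solution in $\mathbb{R}^2$ of the stochastic differential equation $$dX_t=(a_1X_t-\alpha_1X_t^2+Y_t^2)\,dt+\sqrt{2\kappa_1}\,dB^{(1)}_t,\qquad dY_t=(a_2Y_t-\alpha_2X_tY_t)\,dt+\sqrt{2\kappa_2}\,dB^{(2)}_t,$$ with explosion time $\tau$. If $\alpha_1>\alpha_2$, then there exists a non-empty set $A\subset\mathbb{R}^2$ such that for all $z\in A$, $P_z\{\tau<\infty\}>0$.
   Context: $B^{(1)}_t$ and $B^{(2)}_t$ are independent standard one-dimensional Brownian motions on a common probability space $(\Omega,\mathcal{F},P)$. $P_z$ denotes the law when $Z_0=z\in\mathbb{R}^2$. Explosion time: $\tau_n=\inf\{t>0: |Z_t|\ge n\}$ for $n\in\mathbb{N}$, and $\tau=\lim_{n\to\infty}\tau_n\in[0,\infty]$; the solution is defined up to time $\tau$. *)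

theory Defs
  imports "HOL-Probability.Probability"
begin

text \<open>Processes are indexed by real times, of which only the nonnegative ones matter.\<close>

definition standard_brownian_motion :: "'w measure \<Rightarrow> (real \<Rightarrow> 'w \<Rightarrow> real) \<Rightarrow> bool" where
  "standard_brownian_motion M B \<longleftrightarrow>
     (\<forall>t\<ge>0. B t \<in> borel_measurable M) \<and>
     (AE \<omega> in M. B 0 \<omega> = 0) \<and>
     (\<forall>s t. 0 \<le> s \<and> s < t \<longrightarrow>
        distributed M lborel (\<lambda>\<omega>. B t \<omega> - B s \<omega>) (normal_density 0 (sqrt (t - s)))) \<and>
     (\<forall>(n::nat) (t :: nat \<Rightarrow> real). 0 \<le> t 0 \<and> (\<forall>i<n. t i \<le> t (Suc i)) \<longrightarrow>
        prob_space.indep_vars M (\<lambda>_. borel) (\<lambda>i \<omega>. B (t (Suc i)) \<omega> - B (t i) \<omega>) {..<n}) \<and>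
     (AE \<omega> in M. continuous_on {0..} (\<lambda>t. B t \<omega>))"

definition independent_processes ::
  "'w measure \<Rightarrow> (real \<Rightarrow> 'w \<Rightarrow> real) \<Rightarrow> (real \<Rightarrow> 'w \<Rightarrow> real) \<Rightarrow> bool" where
  "independent_processes M B1 B2 \<longleftrightarrow>
     prob_space.indep_var M
       (Pi\<^sub>M {0..} (\<lambda>_. borel)) (\<lambda>\<omega>. \<lambda>t\<in>{0..}. B1 t \<omega>)
       (Pi\<^sub>M {0..} (\<lambda>_. borel)) (\<lambda>\<omega>. \<lambda>t\<in>{0..}. B2 t \<omega>)"

text \<open>The filtration generated by the pair \<open>(B1, B2)\<close>, augmented by the null sets of \<open>M\<close>.\<close>

definition brownian_filtration ::
  "'w measure \<Rightarrow> (real \<Rightarrow> 'w \<Rightarrow> real) \<Rightarrow> (real \<Rightarrow> 'w \<Rightarrow> real) \<Rightarrow> real \<Rightarrow> 'w measure" where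
  "brownian_filtration M B1 B2 t =
     sigma (space M)
       ({B s -` S \<inter> space M | B s S. B \<in> {B1, B2} \<and> 0 \<le> s \<and> s \<le> t \<and> S \<in> sets borel}
        \<union> null_sets M)"

text \<open>
  A path \<open>w\<close> that is defined on \<open>[0, \<zeta>)\<close> only is represented by a total function together with
  its lifetime \<open>\<zeta>\<close>; the values of \<open>w\<close> from time \<open>\<zeta>\<close> on are irrelevant and are never inspected.
  The infimum of the empty set is \<open>\<infinity>\<close>.
\<close>

definition hitting_time :: "(real \<Rightarrow> real \<times> real) \<Rightarrow> ereal \<Rightarrow> nat \<Rightarrow> ereal" where
  "hitting_time w \<zeta> n = Inf {ereal t | t. 0 < t \<and> ereal t < \<zeta> \<and> real n \<le> norm (w t)}"

definition explosion_time :: "(real \<Rightarrow> real \<times> real) \<Rightarrow> ereal \<Rightarrow> ereal" where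
  "explosion_time w \<zeta> = lim (\<lambda>n. hitting_time w \<zeta> n)"

text \<open>
  \<open>sde_solution M B1 B2 b \<sigma>1 \<sigma>2 z Z \<tau>\<close>: the process \<open>Z\<close>, defined up to time \<open>\<tau>\<close>, is a strong
  solution of \<open>dZ = b(Z) dt + (\<sigma>1 dB1, \<sigma>2 dB2)\<close> with \<open>Z\<^sub>0 = z\<close>, and \<open>\<tau>\<close> is its explosion time.
  The equation is meant in integrated form on \<open>[0, \<tau>)\<close>. Because \<open>\<sigma>1\<close>, \<open>\<sigma>2\<close> are constants and
  \<open>B1\<close>, \<open>B2\<close> start at 0, the stochastic integrals are \<open>\<sigma>1 B1\<^sub>t\<close> and \<open>\<sigma>2 B2\<^sub>t\<close>.
  The condition \<open>\<tau> = explosion_time Z \<tau>\<close> says that the lifetime of the solution is its explosion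
  time; it excludes solutions stopped before explosion, and it forces \<open>\<tau> > 0\<close>.
\<close>

definition sde_solution ::
  "'w measure \<Rightarrow> (real \<Rightarrow> 'w \<Rightarrow> real) \<Rightarrow> (real \<Rightarrow> 'w \<Rightarrow> real) \<Rightarrow>
   (real \<times> real \<Rightarrow> real \<times> real) \<Rightarrow> real \<Rightarrow> real \<Rightarrow> real \<times> real \<Rightarrow>
   (real \<Rightarrow> 'w \<Rightarrow> real \<times> real) \<Rightarrow> ('w \<Rightarrow> ereal) \<Rightarrow> bool" where
  "sde_solution M B1 B2 b \<sigma>1 \<sigma>2 z Z \<tau> \<longleftrightarrow>
     (\<forall>t\<ge>0. {\<omega> \<in> space M. ereal t < \<tau> \<omega>} \<in> sets (brownian_filtration M B1 B2 t) \<and>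
        Z t \<in> borel_measurable
          (restrict_space (brownian_filtration M B1 B2 t) {\<omega> \<in> space M. ereal t < \<tau> \<omega>})) \<and>
     (AE \<omega> in M.
        \<tau> \<omega> = explosion_time (\<lambda>t. Z t \<omega>) (\<tau> \<omega>) \<and>
        continuous_on {t. 0 \<le> t \<and> ereal t < \<tau> \<omega>} (\<lambda>t. Z t \<omega>) \<and>
        (\<forall>t. 0 \<le> t \<and> ereal t < \<tau> \<omega> \<longrightarrow>
           (\<lambda>s. b (Z s \<omega>)) absolutely_integrable_on {0..t} \<and>
           Z t \<omega> = z + integral {0..t} (\<lambda>s. b (Z s \<omega>)) + (\<sigma>1 * B1 t \<omega>, \<sigma>2 * B2 t \<omega>)))"

end

theory Submission
  imports Defs
begin

text \<open>
  Brownian paths are bounded on \<open>[0, 1]\<close>, so some bound \<open>K\<close> holds there for both noise terms with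
  positive probability. Subtracting the noise from the solution gives \<open>(-p, v)\<close>, which solves an
  ordinary differential equation that is a bounded perturbation of the noiseless one. Since
  \<open>\<alpha>1 > \<alpha>2\<close>, a thin cone \<open>\<bar>v\<bar> \<le> \<delta> p\<close> around the negative \<open>x\<close>-axis is forward invariant far from
  the origin, and inside it \<open>p' \<ge> c p\<^sup>2\<close>. Starting from \<open>(-R, 0)\<close> with \<open>R\<close> large compared
  with \<open>K\<close>, the solution therefore explodes before time 1 whenever the noise is bounded by \<open>K\<close>.
\<close>

section \<open>Differential inequalities: barriers and blow-up\<close>

text \<open>Up to the first time \<open>r\<close> at which one of the functions reaches
  \<open>c\<close>, both have nonnegative derivative, so at \<open>r\<close> both are still at least
  their initial values, which exceed \<open>c\<close>. The functions are treated as a pair because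
  each derivative is controlled only while both bounds hold.\<close>

lemma nondecreasing_barrier_pair:
  fixes f g f' g' :: "real \<Rightarrow> real"
  assumes f: "\<And>t. t \<in> {0..T} \<Longrightarrow> (f has_real_derivative f' t) (at t within {0..T})"
    and g: "\<And>t. t \<in> {0..T} \<Longrightarrow> (g has_real_derivative g' t) (at t within {0..T})"
    and init: "f 0 > c" "g 0 > c"
    and inward: "\<And>t. t \<in> {0..T} \<Longrightarrow> f t \<ge> c \<Longrightarrow> g t \<ge> c \<Longrightarrow> f' t \<ge> 0 \<and> g' t \<ge> 0"
    and t: "t \<in> {0..T}"
  shows "f t > c \<and> g t > c"
proof (rule ccontr)
  assume neg: "\<not> (f t > c \<and> g t > c)"
  define S where "S = {s \<in> {0..T}. min (f s) (g s) \<le> c}"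
  have contf: "continuous_on {0..T} f" and contg: "continuous_on {0..T} g"
    by (rule DERIV_continuous_on, erule f) (rule DERIV_continuous_on, erule g)
  have "closed S"
    unfolding S_def by (intro continuous_on_closed_Collect_le
        continuous_on_min contf contg continuous_on_const closed_atLeastAtMost)
  moreover have "S \<noteq> {}" "bdd_below S"
    using t neg by (auto simp: S_def bdd_below_def)
  ultimately have mem: "Inf S \<in> S"
    by (rule closed_contains_Inf[rotated -1])
  define r where "r = Inf S"
  have r: "r \<in> {0..T}" "min (f r) (g r) \<le> c"
    using mem by (auto simp: r_def S_def)
  have before: "f s > c \<and> g s > c" if "0 \<le> s" "s < r" for s
  proof (rule ccontr)
    assume "\<not> ?thesis"
    then have "s \<in> S" using that r by (auto simp: S_def)
    then have "r \<le> s" unfolding r_def using \<open>bdd_below S\<close> by (rule cInf_lower)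
    then show False using that by simp
  qed
  have "r \<noteq> 0" using r init by (auto simp: min_def split: if_splits)
  then have r0: "0 < r" using r by auto
  \<comment> \<open>The sign of the derivative is known only before \<open>r\<close>, so derivatives
    on the open interval are combined with continuity at its ends.\<close>
  have mono: "h 0 \<le> h r"
    if h: "\<And>t. t \<in> {0..T} \<Longrightarrow> (h has_real_derivative h' t) (at t within {0..T})"
      and h': "\<And>s. 0 < s \<Longrightarrow> s < r \<Longrightarrow> h' s \<ge> 0" for h h' :: "real \<Rightarrow> real"
  proof (rule DERIV_nonneg_imp_increasing_open[where f = h])
    show "continuous_on {0..r} h"
      by (rule continuous_on_subset[of "{0..T}"]) (use r in \<open>auto intro: DERIV_continuous_on h\<close>)
    show "\<exists>y. DERIV h s :> y \<and> y \<ge> 0" if s: "0 < s" "s < r" for s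
    proof -
      have "s \<in> interior {0..T}" using s r by auto
      then have "at s within {0..T} = at s" by (rule at_within_interior)
      then show ?thesis
        using h[of s] h'[of s] s r by auto
    qed
  qed (use r0 in simp)
  have "f' s \<ge> 0 \<and> g' s \<ge> 0" if "0 < s" "s < r" for s
    using inward[of s] before[of s] that r by auto
  then have "f 0 \<le> f r" "g 0 \<le> g r" using mono f g by blast+
  then show False using r init by (auto simp: min_def split: if_splits)
qed

text \<open>Dividing \<open>p' \<ge> c * p\<^sup>2\<close> by \<open>p\<^sup>2\<close> shows that
  \<open>- 1 / p - c * t\<close> is nondecreasing. Comparing its values at 0 and \<open>T\<close>
  bounds the time for which such a \<open>p\<close> can exist; strictness comes from
  \<open>1 / p T > 0\<close>.\<close>

lemma quadratic_growth_bound: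
  fixes p p' :: "real \<Rightarrow> real"
  assumes p: "\<And>t. t \<in> {0..T} \<Longrightarrow> (p has_real_derivative p' t) (at t within {0..T})"
    and pos: "\<And>t. t \<in> {0..T} \<Longrightarrow> p t > 0"
    and growth: "\<And>t. t \<in> {0..T} \<Longrightarrow> p' t \<ge> c * (p t)\<^sup>2"
    and "0 \<le> T"
  shows "c * T < 1 / p 0"
proof -
  have "- (1 / p 0) - c * 0 \<le> - (1 / p T) - c * T"
  proof (rule DERIV_nonneg_imp_increasing_open[OF \<open>0 \<le> T\<close>])
    have "continuous_on {0..T} p" using p by (rule DERIV_continuous_on)
    then show "continuous_on {0..T} (\<lambda>t. - (1 / p t) - c * t)"
      using pos by (intro continuous_intros) force+
    show "\<exists>y. ((\<lambda>t. - (1 / p t) - c * t) has_real_derivative y) (at t) \<and> y \<ge> 0"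
      if t: "0 < t" "t < T" for t
    proof -
      have "at t within {0..T} = at t"
        by (rule at_within_interior) (use t in auto)
      then have "(p has_real_derivative p' t) (at t)" using p[of t] t by auto
      then have "((\<lambda>t. - (1 / p t) - c * t) has_real_derivative p' t / (p t)\<^sup>2 - c) (at t)"
        using pos[of t] t by (auto intro!: derivative_eq_intros simp: power2_eq_square)
      moreover have "p' t / (p t)\<^sup>2 - c \<ge> 0"
        using growth[of t] pos[of t] t by (simp add: field_simps)
      ultimately show ?thesis by blast
    qed
  qed
  moreover have "1 / p T > 0" using pos[of T] \<open>0 \<le> T\<close> by simp
  ultimately show ?thesis by linarith
qed

section \<open>The invariant cone and deterministic explosion\<close>

text \<open>Here \<delta> is the slope of the cone and \<theta> the size of the noise and of the
  linear coefficients relative to \<open>p\<close>. After multiplication by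
  \<open>p\<^sup>2\<close>, the left side bounds the transversal speed and the right side is
  \<delta> times the guaranteed radial speed. At \<theta> = 0 the inequality reads
  \<open>\<delta>\<^sup>2 \<le> \<alpha>1 - \<alpha>2\<close>; if it is strict there, continuity
  preserves it for small \<theta> > 0.\<close>

lemma cone_parameters:
  fixes \<alpha>1 \<alpha>2 :: real
  assumes "\<alpha>2 > 0" "\<alpha>1 > \<alpha>2"
  obtains \<delta> \<theta> where "\<delta> > 0" "0 < \<theta>" "\<theta> < 1"
    "(\<theta> + \<alpha>2 * (1 + \<theta>)) * (\<delta> + \<theta>) \<le> \<delta> * (\<alpha>1 * (1 - \<theta>)\<^sup>2 - \<theta> * (1 + \<theta>) - (\<delta> + \<theta>)\<^sup>2)"
proof -
  \<comment> \<open>Half of the largest admissible squared slope, so that the inequality is strict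
    at \<theta> = 0.\<close>
  define \<delta> where "\<delta> = sqrt ((\<alpha>1 - \<alpha>2) / 2)"
  have d: "\<delta> > 0" "\<delta>\<^sup>2 = (\<alpha>1 - \<alpha>2) / 2" using assms by (auto simp: \<delta>_def)
  define h where "h \<theta> = \<delta> * (\<alpha>1 * (1 - \<theta>)\<^sup>2 - \<theta> * (1 + \<theta>) - (\<delta> + \<theta>)\<^sup>2)
      - (\<theta> + \<alpha>2 * (1 + \<theta>)) * (\<delta> + \<theta>)" for \<theta> :: real
  have "isCont h 0" unfolding h_def by (intro continuous_intros)
  then have "(h \<longlongrightarrow> h 0) (at_right 0)"
    by (auto simp: isCont_def intro: tendsto_within_subset[of _ _ _ UNIV])
  moreover have "h 0 = \<delta> * ((\<alpha>1 - \<alpha>2) / 2)"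
    by (simp add: h_def d algebra_simps) (simp add: field_simps)
  then have "h 0 > 0" using d(1) assms by (simp only:) (intro mult_pos_pos, auto)
  ultimately have "eventually (\<lambda>\<theta>. h \<theta> > 0) (at_right 0)" by (rule order_tendstoD)
  moreover have "eventually (\<lambda>\<theta>::real. 0 < \<theta> \<and> \<theta> < 1) (at_right 0)"
    by (auto intro!: eventually_conj eventually_at_right_less eventually_at_rightI[of 0 1])
  ultimately have "eventually (\<lambda>\<theta>. h \<theta> > 0 \<and> 0 < \<theta> \<and> \<theta> < 1) (at_right 0)"
    by (rule eventually_conj)
  then obtain \<theta> where "h \<theta> > 0" "0 < \<theta>" "\<theta> < 1"
    using eventually_happens[of _ "at_right (0::real)"] trivial_limit_at_right_real by blast
  then show ?thesis using that[of \<delta> \<theta>] d by (simp add: h_def)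
qed

text \<open>With \<open>x = w1 - p\<close> and \<open>y = v + w2\<close>, the smallness assumptions
  place \<open>p - w1\<close> between \<open>(1 - \<theta>) * p\<close> and
  \<open>(1 + \<theta>) * p\<close> and give
  \<open>\<bar>y\<bar> \<le> (\<delta> + \<theta>) * p\<close>. Bounding \<open>a1\<close> and
  \<open>a2\<close> by multiples of \<open>p\<close> makes even the linear drift terms quadratic in
  \<open>p\<close>.\<close>

lemma drift_estimates:
  fixes p v w1 w2 a1 a2 \<alpha>1 \<alpha>2 \<delta> \<theta> :: real
  assumes "\<alpha>1 > 0" "\<alpha>2 > 0" "0 < \<theta>" "\<theta> < 1" "\<delta> > 0" "p \<ge> 0"
    and small: "\<bar>w1\<bar> \<le> \<theta> * p" "\<bar>w2\<bar> \<le> \<theta> * p" "\<bar>a1\<bar> \<le> \<theta> * p" "\<bar>a2\<bar> \<le> \<theta> * p"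
    and cone: "\<bar>v\<bar> \<le> \<delta> * p"
  shows "(\<alpha>1 * (1 - \<theta>)\<^sup>2 - \<theta> * (1 + \<theta>) - (\<delta> + \<theta>)\<^sup>2) * p\<^sup>2
           \<le> - (a1 * (w1 - p) - \<alpha>1 * (w1 - p)\<^sup>2 + (v + w2)\<^sup>2)"
    and "\<bar>a2 * (v + w2) - \<alpha>2 * (w1 - p) * (v + w2)\<bar>
           \<le> (\<theta> + \<alpha>2 * (1 + \<theta>)) * (\<delta> + \<theta>) * p\<^sup>2"
proof -
  have lower: "(1 - \<theta>) * p \<le> p - w1" and upper: "\<bar>p - w1\<bar> \<le> (1 + \<theta>) * p"
    using small(1) \<open>p \<ge> 0\<close> by (auto simp: algebra_simps abs_le_iff)
  have y: "\<bar>v + w2\<bar> \<le> (\<delta> + \<theta>) * p"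
    using small(2) cone by (simp add: algebra_simps)
  have "((1 - \<theta>) * p)\<^sup>2 \<le> (p - w1)\<^sup>2"
    using lower assms by (intro power_mono) auto
  then have "\<alpha>1 * (1 - \<theta>)\<^sup>2 * p\<^sup>2 \<le> \<alpha>1 * (w1 - p)\<^sup>2"
    using \<open>\<alpha>1 > 0\<close> by (simp add: power_mult_distrib power2_commute mult.assoc)
  moreover have "(v + w2)\<^sup>2 \<le> (\<delta> + \<theta>)\<^sup>2 * p\<^sup>2"
    using power_mono[OF y, of 2] by (simp add: power_mult_distrib)
  moreover have "\<bar>a1 * (w1 - p)\<bar> \<le> (\<theta> * p) * ((1 + \<theta>) * p)"
    unfolding abs_mult using small(3) upper assms
    by (intro mult_mono) (auto simp: abs_minus_commute)
  then have "\<bar>a1 * (w1 - p)\<bar> \<le> \<theta> * (1 + \<theta>) * p\<^sup>2"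
    by (simp only: power2_eq_square ac_simps)
  ultimately show "(\<alpha>1 * (1 - \<theta>)\<^sup>2 - \<theta> * (1 + \<theta>) - (\<delta> + \<theta>)\<^sup>2) * p\<^sup>2
      \<le> - (a1 * (w1 - p) - \<alpha>1 * (w1 - p)\<^sup>2 + (v + w2)\<^sup>2)"
    unfolding left_diff_distrib by linarith
  \<comment> \<open>The second drift component factors as
    \<open>(a2 + \<alpha>2 * (p - w1)) * (v + w2)\<close>; the two factors are bounded
    separately.\<close>
  have "\<bar>\<alpha>2 * (p - w1)\<bar> \<le> \<alpha>2 * ((1 + \<theta>) * p)"
    using upper \<open>\<alpha>2 > 0\<close> by (simp add: abs_mult)
  then have "\<bar>a2 + \<alpha>2 * (p - w1)\<bar> \<le> (\<theta> + \<alpha>2 * (1 + \<theta>)) * p"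
    using small(4) by (simp add: algebra_simps)
  then have "\<bar>a2 + \<alpha>2 * (p - w1)\<bar> * \<bar>v + w2\<bar>
      \<le> ((\<theta> + \<alpha>2 * (1 + \<theta>)) * p) * ((\<delta> + \<theta>) * p)"
    using y assms by (intro mult_mono) auto
  moreover have "a2 * (v + w2) - \<alpha>2 * (w1 - p) * (v + w2) = (a2 + \<alpha>2 * (p - w1)) * (v + w2)"
    by (simp add: algebra_simps)
  ultimately show "\<bar>a2 * (v + w2) - \<alpha>2 * (w1 - p) * (v + w2)\<bar>
      \<le> (\<theta> + \<alpha>2 * (1 + \<theta>)) * (\<delta> + \<theta>) * p\<^sup>2"
    by (simp only: abs_mult power2_eq_square ac_simps)
qed

text \<open>This is the pathwise core: \<open>R\<close> depends only on \<open>K\<close> and the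
  coefficients, so one starting point serves all noise paths bounded by \<open>K\<close>.\<close>

lemma no_solution_on_unit_interval:
  fixes a1 a2 \<alpha>1 \<alpha>2 K :: real
  assumes pos: "\<alpha>1 > 0" "\<alpha>2 > 0" "\<alpha>1 > \<alpha>2"
  obtains R :: real where
    "\<And>(w1 :: real \<Rightarrow> real) w2 z. (\<And>t. t \<in> {0..1} \<Longrightarrow> \<bar>w1 t\<bar> \<le> K \<and> \<bar>w2 t\<bar> \<le> K) \<Longrightarrow> continuous_on {0..1} z \<Longrightarrow>
      (\<And>t. t \<in> {0..1} \<Longrightarrow> z t = (- R, 0)
        + integral {0..t} (\<lambda>s. (\<lambda>(x, y). (a1 * x - \<alpha>1 * x\<^sup>2 + y\<^sup>2, a2 * y - \<alpha>2 * x * y)) (z s))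
        + (w1 t, w2 t)) \<Longrightarrow> False"
proof -
  obtain \<delta> \<theta> where dt: "\<delta> > 0" "0 < \<theta>" "\<theta> < 1"
    "(\<theta> + \<alpha>2 * (1 + \<theta>)) * (\<delta> + \<theta>) \<le> \<delta> * (\<alpha>1 * (1 - \<theta>)\<^sup>2 - \<theta> * (1 + \<theta>) - (\<delta> + \<theta>)\<^sup>2)"
    using cone_parameters pos by metis
  define c where "c = \<alpha>1 * (1 - \<theta>)\<^sup>2 - \<theta> * (1 + \<theta>) - (\<delta> + \<theta>)\<^sup>2"
  define d where "d = (\<theta> + \<alpha>2 * (1 + \<theta>)) * (\<delta> + \<theta>)"
  have "d > 0" using dt pos by (simp add: d_def add_pos_pos)
  have "d \<le> \<delta> * c" using dt by (simp add: c_def d_def)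
  \<comment> \<open>Positivity of the growth rate \<open>c\<close> is read off from the cone
    inequality, whose left side \<open>d\<close> is positive.\<close>
  with \<open>d > 0\<close> have "\<delta> * c > 0" by linarith
  then have "c > 0" using dt by (simp add: zero_less_mult_iff)
  define L where "L = \<bar>K\<bar> + \<bar>a1\<bar> + \<bar>a2\<bar>"
  \<comment> \<open>The term \<open>2 * L / \<theta>\<close> keeps the noise bound and the linear
    coefficients below \<open>\<theta> * p\<close> while \<open>p \<ge> R / 2\<close>. The term
    \<open>1 / c\<close> makes the blow-up time bound \<open>1 / (c * R)\<close> at most 1.\<close>
  define R where "R = 2 * L / \<theta> + 1 / c"
  have "L \<ge> 0" by (simp add: L_def)
  have "1 / c > 0" using \<open>c > 0\<close> by simp
  have "2 * L / \<theta> \<ge> 0" using \<open>L \<ge> 0\<close> dt by simp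
  have R: "R > 0" "R \<ge> 1 / c" "R \<ge> 2 * L / \<theta>"
    using \<open>1 / c > 0\<close> \<open>2 * L / \<theta> \<ge> 0\<close> unfolding R_def by linarith+
  have L: "L \<le> \<theta> * (R / 2)" using R(3) dt(2) by (simp add: field_simps)
  show ?thesis
  proof (rule that[of R])
    fix w1 w2 :: "real \<Rightarrow> real" and z :: "real \<Rightarrow> real \<times> real"
    assume w: "\<And>t. t \<in> {0..1} \<Longrightarrow> \<bar>w1 t\<bar> \<le> K \<and> \<bar>w2 t\<bar> \<le> K"
      and contz: "continuous_on {0..1} z"
      and eq: "\<And>t. t \<in> {0..1} \<Longrightarrow> z t = (- R, 0)
        + integral {0..t} (\<lambda>s. (\<lambda>(x, y). (a1 * x - \<alpha>1 * x\<^sup>2 + y\<^sup>2, a2 * y - \<alpha>2 * x * y)) (z s))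
        + (w1 t, w2 t)"
    define b where "b s = (a1 * fst (z s) - \<alpha>1 * (fst (z s))\<^sup>2 + (snd (z s))\<^sup>2,
      a2 * snd (z s) - \<alpha>2 * fst (z s) * snd (z s))" for s
    have contb: "continuous_on {0..1} b"
      unfolding b_def by (intro continuous_intros contz)
    \<comment> \<open>The noise need not be differentiable, but \<open>I\<close> is: the drift along
      the continuous path \<open>z\<close> is continuous, so the fundamental theorem of calculus
      applies.\<close>
    define I where "I t = integral {0..t} b" for t
    have I': "(I has_vector_derivative b t) (at t within {0..1})" if "t \<in> {0..1}" for t
      unfolding I_def by (rule integral_has_vector_derivative[OF contb that])
    have zI: "z t = (- R, 0) + I t + (w1 t, w2 t)" if "t \<in> {0..1}" for t
      using eq[OF that] by (simp add: I_def b_def[abs_def] case_prod_beta)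
    define p where "p t = R - fst (I t)" for t
    define v where "v t = snd (I t)" for t
    have x: "fst (z t) = w1 t - p t" and y: "snd (z t) = v t + w2 t" if "t \<in> {0..1}" for t
      using zI[OF that] by (auto simp: p_def v_def)
    have p': "(p has_real_derivative - fst (b t)) (at t within {0..1})"
      and v': "(v has_real_derivative snd (b t)) (at t within {0..1})" if "t \<in> {0..1}" for t
      unfolding p_def v_def has_real_derivative_iff_has_vector_derivative
      using bounded_linear.has_vector_derivative[OF bounded_linear_fst I'[OF that]]
        bounded_linear.has_vector_derivative[OF bounded_linear_snd I'[OF that]]
      by (auto intro!: derivative_eq_intros)
    have I0: "I 0 = 0" by (simp add: I_def)
    have est: "c * (p t)\<^sup>2 \<le> - fst (b t)" "\<bar>snd (b t)\<bar> \<le> d * (p t)\<^sup>2"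
      if "t \<in> {0..1}" "p t \<ge> R / 2" "\<bar>v t\<bar> \<le> \<delta> * p t" for t
    proof -
      have "L \<le> \<theta> * p t"
        using L mult_left_mono[OF that(2), of \<theta>] dt by linarith
      then have "\<bar>w1 t\<bar> \<le> \<theta> * p t" "\<bar>w2 t\<bar> \<le> \<theta> * p t" "\<bar>a1\<bar> \<le> \<theta> * p t" "\<bar>a2\<bar> \<le> \<theta> * p t"
        using w[OF that(1)] by (auto simp: L_def)
      note drift_estimates[OF pos(1,2) dt(2,3,1) _ this that(3)]
      moreover have "p t \<ge> 0" using that R by linarith
      ultimately show "c * (p t)\<^sup>2 \<le> - fst (b t)" "\<bar>snd (b t)\<bar> \<le> d * (p t)\<^sup>2"
        by (simp_all add: c_def d_def b_def x[OF that(1)] y[OF that(1)])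
    qed
    \<comment> \<open>The two sides of the cone become lower bounds on
      \<open>\<delta> * p - v\<close> and \<open>\<delta> * p + v\<close>, both of which start at
      \<open>\<delta> * R\<close>. The positive level \<open>\<delta> * R / 2\<close> serves twice:
      each bound keeps the path off one side of the cone, and their sum gives
      \<open>p > R / 2\<close>, the range in which \<open>est\<close> applies.\<close>
    have cone: "\<delta> * p t - v t > \<delta> * R / 2 \<and> \<delta> * p t + v t > \<delta> * R / 2" if t: "t \<in> {0..1}" for t
    proof (rule nondecreasing_barrier_pair[OF _ _ _ _ _ t])
      fix s :: real assume s: "s \<in> {0..1}"
      show "((\<lambda>t. \<delta> * p t - v t) has_real_derivative \<delta> * - fst (b s) - snd (b s)) (at s within {0..1})"
        "((\<lambda>t. \<delta> * p t + v t) has_real_derivative \<delta> * - fst (b s) + snd (b s)) (at s within {0..1})"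
        using p'[OF s] v'[OF s] by (auto intro!: derivative_eq_intros)
      assume bar: "\<delta> * R / 2 \<le> \<delta> * p s - v s" "\<delta> * R / 2 \<le> \<delta> * p s + v s"
      then have "\<delta> * (R / 2) \<le> \<delta> * p s" by simp
      then have ps: "R / 2 \<le> p s" using dt by simp
      have "\<delta> * R / 2 > 0" using dt R by simp
      then have "\<bar>v s\<bar> \<le> \<delta> * p s" using bar by linarith
      note est[OF s ps this]
      \<comment> \<open>Together with \<open>est\<close>, this bounds the absolute value of the
        derivative of \<open>v\<close> by \<delta> times that of \<open>p\<close>, so both barrier
        functions have nonnegative derivative.\<close>
      moreover have "d * (p s)\<^sup>2 \<le> \<delta> * (c * (p s)\<^sup>2)"
        using mult_right_mono[OF \<open>d \<le> \<delta> * c\<close>, of "(p s)\<^sup>2"] by (simp add: mult.assoc)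
      moreover have "\<delta> * (c * (p s)\<^sup>2) \<le> \<delta> * - fst (b s)"
        using calculation(1) dt by (intro mult_left_mono) auto
      ultimately show "\<delta> * - fst (b s) - snd (b s) \<ge> 0 \<and> \<delta> * - fst (b s) + snd (b s) \<ge> 0"
        by linarith
    qed (use dt R in \<open>auto simp: p_def v_def I0\<close>)
    have big: "p t \<ge> R / 2" "\<bar>v t\<bar> \<le> \<delta> * p t" if "t \<in> {0..1}" for t
    proof -
      have "\<delta> * (R / 2) \<le> \<delta> * p t" using cone[OF that] by simp
      then show "p t \<ge> R / 2" using dt by simp
      have "\<delta> * R / 2 > 0" using dt R by simp
      then show "\<bar>v t\<bar> \<le> \<delta> * p t" using cone[OF that] by linarith
    qed
    have "p t > 0" if "t \<in> {0..1}" for t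
      using big(1)[OF that] R by linarith
    \<comment> \<open>Existence up to time 1 would force \<open>c < 1 / R\<close>, against the
      choice of \<open>R\<close>.\<close>
    then have "c * 1 < 1 / p 0"
      by (intro quadratic_growth_bound[OF p']) (use est(1) big in auto)
    then have "c < 1 / R" by (simp add: p_def I0)
    moreover have "1 / R \<le> c" using R \<open>c > 0\<close> by (simp add: field_simps)
    ultimately show False by simp
  qed
qed

section \<open>Brownian paths: measurability and boundedness\<close>

text \<open>This turns the adaptedness of the lifetime in \<open>sde_solution\<close> into
  measurability with respect to \<open>M\<close>.\<close>

lemma sets_brownian_filtration_subset:
  assumes "standard_brownian_motion M B1" "standard_brownian_motion M B2"
  shows "sets (brownian_filtration M B1 B2 t) \<subseteq> sets M"
proof -
  have "B s \<in> borel_measurable M" if "B \<in> {B1, B2}" "0 \<le> s" for B s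
    using assms that by (auto simp: standard_brownian_motion_def)
  then have sub: "{B s -` S \<inter> space M | B s S. B \<in> {B1, B2} \<and> 0 \<le> s \<and> s \<le> t \<and> S \<in> sets borel}
        \<union> null_sets M \<subseteq> sets M"
    by (auto simp del: insert_iff intro: measurable_sets)
  then show ?thesis
    unfolding brownian_filtration_def sets_measure_of[OF order.trans[OF sub sets.space_closed]]
    by (rule sets.sigma_sets_subset)
qed

text \<open>Continuous paths are bounded on the compact unit interval, so the events
  \<open>E n\<close> together cover almost every outcome; a countable union of null sets is null,
  hence some \<open>E n\<close> has positive probability. The bound holds on \<open>E\<close> up to
  a null set because continuity itself is only almost sure.\<close>

lemma brownian_paths_bounded_with_positive_probability:
  assumes "prob_space M" "standard_brownian_motion M B1" "standard_brownian_motion M B2"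
  obtains K :: real and E where "E \<in> sets M" "measure M E > 0"
    "AE \<omega> in M. \<omega> \<in> E \<longrightarrow> (\<forall>t\<in>{0..1}. \<bar>B1 t \<omega>\<bar> \<le> K \<and> \<bar>B2 t \<omega>\<bar> \<le> K)"
proof -
  interpret prob_space M by fact
  \<comment> \<open>Restricting to rational times makes the events measurable; path continuity gives the rest.\<close>
  define Q where "Q = ({0<..<1} \<inter> \<rat> :: real set)"
  define E where "E n = {\<omega> \<in> space M. \<forall>q\<in>Q. \<bar>B1 q \<omega>\<bar> \<le> real n \<and> \<bar>B2 q \<omega>\<bar> \<le> real n}" for n
  have "countable Q" unfolding Q_def by (intro countable_Int2 countable_rat)
  have meas: "B1 q \<in> borel_measurable M" "B2 q \<in> borel_measurable M" if "q \<in> Q" for q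
    using assms that by (auto simp: standard_brownian_motion_def Q_def)
  have E: "E n \<in> sets M" for n
    unfolding E_def
    by (intro sets.sets_Collect_countable_All' \<open>countable Q\<close> sets.sets_Collect_conj
        borel_measurable_le borel_measurable_abs meas borel_measurable_const)
  have cont: "AE \<omega> in M. continuous_on {0..} (\<lambda>t. B1 t \<omega>) \<and> continuous_on {0..} (\<lambda>t. B2 t \<omega>)"
    using assms by (auto simp: standard_brownian_motion_def)
  have "AE \<omega> in M. \<omega> \<in> (\<Union>n. E n)"
    using cont AE_space
  proof eventually_elim
    case (elim \<omega>)
    have "\<exists>n. \<forall>t\<in>{0..1}. \<bar>f t\<bar> \<le> real n" if "continuous_on {0..} f" for f :: "real \<Rightarrow> real"
    proof -
      have "compact (f ` {0..1})"
        using that by (intro compact_continuous_image) (auto intro: continuous_on_subset)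
      then obtain C where "\<forall>x\<in>f ` {0..1}. norm x \<le> C"
        using compact_imp_bounded bounded_iff by metis
      moreover obtain n where "C \<le> real n" using real_arch_simple by blast
      ultimately show ?thesis by (intro exI[of _ n]) force
    qed
    from this[of "\<lambda>t. B1 t \<omega>"] this[of "\<lambda>t. B2 t \<omega>"] elim
    obtain n m where nm: "\<forall>t\<in>{0..1}. \<bar>B1 t \<omega>\<bar> \<le> real n" "\<forall>t\<in>{0..1}. \<bar>B2 t \<omega>\<bar> \<le> real m" by blast
    have "\<bar>B1 q \<omega>\<bar> \<le> real (max n m) \<and> \<bar>B2 q \<omega>\<bar> \<le> real (max n m)" if "q \<in> Q" for q
    proof -
      have "q \<in> {0..1}" using that by (simp add: Q_def)
      with nm have "\<bar>B1 q \<omega>\<bar> \<le> real n" "\<bar>B2 q \<omega>\<bar> \<le> real m" by blast+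
      then show ?thesis by linarith
    qed
    then have "\<omega> \<in> E (max n m)" using elim by (simp add: E_def)
    then show ?case by blast
  qed
  moreover have "(\<Union>n. E n) \<in> sets M" using E by blast
  ultimately have "emeasure M (\<Union>n. E n) = 1"
    by (simp add: emeasure_eq_1_AE)
  moreover have "emeasure M (\<Union>n. E n) = 0" if "\<And>n. emeasure M (E n) = 0"
    using that E by (intro emeasure_UN_eq_0) auto
  ultimately obtain n where "emeasure M (E n) \<noteq> 0" by fastforce
  then have "measure M (E n) > 0" by (simp add: emeasure_eq_measure zero_less_measure_iff)
  moreover have "AE \<omega> in M. \<omega> \<in> E n \<longrightarrow> (\<forall>t\<in>{0..1}. \<bar>B1 t \<omega>\<bar> \<le> real n \<and> \<bar>B2 t \<omega>\<bar> \<le> real n)"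
    using cont
  proof eventually_elim
    case (elim \<omega>)
    have ext: "\<bar>f t\<bar> \<le> real n"
      if f: "continuous_on {0..} f" "\<forall>q\<in>Q. \<bar>f q\<bar> \<le> real n" and t: "t \<in> {0..1}"
      for f :: "real \<Rightarrow> real" and t
    proof -
      \<comment> \<open>Density of the rationals passes to open sets, which is why \<open>Q\<close>
        is taken from the open interval; its closure still contains both endpoints.\<close>
      have "closure Q = closure {0<..<1}"
        unfolding Q_def by (rule closure_open_Int_superset) (auto simp: Rats_closure_real)
      then have "closure Q = {0..1}" by simp
      then show ?thesis
        using continuous_on_subset[OF f(1), of "{0..1}"] f(2) t
        by (intro continuous_le_on_closure[of Q "\<lambda>t. \<bar>f t\<bar>" t "real n"])
          (auto intro: continuous_on_rabs)
    qed
    show ?case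
      using ext[of "\<lambda>t. B1 t \<omega>"] ext[of "\<lambda>t. B2 t \<omega>"] elim by (simp add: E_def)
  qed
  ultimately show ?thesis by (rule that[OF E])
qed

section \<open>Explosion with positive probability\<close>

theorem theorem2p2:
  fixes M :: "'w measure"
    and B1 B2 :: "real \<Rightarrow> 'w \<Rightarrow> real"
    and a1 a2 \<alpha>1 \<alpha>2 \<kappa>1 \<kappa>2 :: real
    and Z :: "real \<times> real \<Rightarrow> real \<Rightarrow> 'w \<Rightarrow> real \<times> real"
    and \<tau> :: "real \<times> real \<Rightarrow> 'w \<Rightarrow> ereal"
  assumes "prob_space M"
    and "standard_brownian_motion M B1"
    and "standard_brownian_motion M B2"
    and "independent_processes M B1 B2"
    and "\<alpha>1 > 0" and "\<alpha>2 > 0" and "\<kappa>1 \<ge> 0" and "\<kappa>2 > 0"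
    and "\<And>z. sde_solution M B1 B2
           (\<lambda>(x, y). (a1 * x - \<alpha>1 * x\<^sup>2 + y\<^sup>2, a2 * y - \<alpha>2 * x * y))
           (sqrt (2 * \<kappa>1)) (sqrt (2 * \<kappa>2)) z (Z z) (\<tau> z)"
    and "\<alpha>1 > \<alpha>2"
  shows "\<exists>A :: (real \<times> real) set. A \<noteq> {} \<and>
           (\<forall>z\<in>A. measure M {\<omega> \<in> space M. \<tau> z \<omega> < \<infinity>} > 0)"
proof -
  interpret prob_space M by fact
  obtain K :: real and E where E: "E \<in> sets M" "measure M E > 0"
    and bnd: "AE \<omega> in M. \<omega> \<in> E \<longrightarrow> (\<forall>t\<in>{0..1}. \<bar>B1 t \<omega>\<bar> \<le> K \<and> \<bar>B2 t \<omega>\<bar> \<le> K)"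
    using brownian_paths_bounded_with_positive_probability assms(1,2,3) by blast
  \<comment> \<open>A common factor for the two diffusion coefficients, so that both scaled noises
    are bounded by \<open>\<sigma> * K\<close>.\<close>
  define \<sigma> where "\<sigma> = max (sqrt (2 * \<kappa>1)) (sqrt (2 * \<kappa>2))"
  \<comment> \<open>The order of choice matters: \<open>K\<close> and \<open>E\<close> concern the
    noise alone and are fixed first, so the starting point may depend on them. The set
    \<open>A\<close> will be the single point \<open>(- R, 0)\<close>.\<close>
  obtain R :: real where R:
    "\<And>(w1 :: real \<Rightarrow> real) w2 z. (\<And>t. t \<in> {0..1} \<Longrightarrow> \<bar>w1 t\<bar> \<le> \<sigma> * K \<and> \<bar>w2 t\<bar> \<le> \<sigma> * K) \<Longrightarrow> continuous_on {0..1} z \<Longrightarrow>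
      (\<And>t. t \<in> {0..1} \<Longrightarrow> z t = (- R, 0)
        + integral {0..t} (\<lambda>s. (\<lambda>(x, y). (a1 * x - \<alpha>1 * x\<^sup>2 + y\<^sup>2, a2 * y - \<alpha>2 * x * y)) (z s))
        + (w1 t, w2 t)) \<Longrightarrow> False"
    using no_solution_on_unit_interval[of \<alpha>1 \<alpha>2 "\<sigma> * K" a1 a2] assms(5,6,10) by blast
  define z :: "real \<times> real" where "z = (- R, 0)"
  have alive: "{\<omega> \<in> space M. ereal t < \<tau> z \<omega>} \<in> sets M" if "t \<ge> 0" for t
    using assms(9)[of z] sets_brownian_filtration_subset[OF assms(2,3), of t] that
    by (auto simp: sde_solution_def)
  \<comment> \<open>The lifetime is finite iff it fails to exceed some natural number. Measurability
    has to be shown because \<open>measure\<close> takes the value 0 on non-measurable sets.\<close>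
  have "{\<omega> \<in> space M. \<tau> z \<omega> < \<infinity>} = (\<Union>n::nat. space M - {\<omega> \<in> space M. ereal (real n) < \<tau> z \<omega>})"
  proof -
    have "\<tau> z \<omega> < \<infinity> \<longleftrightarrow> (\<exists>n::nat. \<not> ereal (real n) < \<tau> z \<omega>)" for \<omega>
      using ereal_dense2 by (cases "\<tau> z \<omega>") (auto simp: not_less real_arch_simple)
    then show ?thesis by auto
  qed
  moreover have "\<dots> \<in> sets M" using alive by auto
  ultimately have S: "{\<omega> \<in> space M. \<tau> z \<omega> < \<infinity>} \<in> sets M" by simp
  have "AE \<omega> in M. continuous_on {t. 0 \<le> t \<and> ereal t < \<tau> z \<omega>} (\<lambda>t. Z z t \<omega>) \<and>
        (\<forall>t. 0 \<le> t \<and> ereal t < \<tau> z \<omega> \<longrightarrow>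
           Z z t \<omega> = z + integral {0..t}
             (\<lambda>s. (\<lambda>(x, y). (a1 * x - \<alpha>1 * x\<^sup>2 + y\<^sup>2, a2 * y - \<alpha>2 * x * y)) (Z z s \<omega>))
           + (sqrt (2 * \<kappa>1) * B1 t \<omega>, sqrt (2 * \<kappa>2) * B2 t \<omega>))"
    using assms(9)[of z] unfolding sde_solution_def by (auto elim!: AE_mp)
  from bnd AE_space this have "AE \<omega> in M. \<omega> \<in> E \<longrightarrow> \<omega> \<in> {\<omega> \<in> space M. \<tau> z \<omega> < \<infinity>}"
  proof eventually_elim
    case (elim \<omega>)
    show ?case
    proof (intro impI CollectI conjI elim(2), rule ccontr)
      \<comment> \<open>An infinite lifetime would make the integral equation hold on all of
        \<open>{0..1}\<close>, which the choice of \<open>R\<close> excludes for noise bounded by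
        \<open>\<sigma> * K\<close>.\<close>
      assume "\<omega> \<in> E" and "\<not> \<tau> z \<omega> < \<infinity>"
      then have inf: "\<tau> z \<omega> = \<infinity>" by simp
      have noise: "\<bar>s * B t \<omega>\<bar> \<le> \<sigma> * K" if "0 \<le> s" "s \<le> \<sigma>" "\<bar>B t \<omega>\<bar> \<le> K"
        for s t and B :: "real \<Rightarrow> 'w \<Rightarrow> real"
        using that by (auto simp: abs_mult intro!: mult_mono)
      show False
      proof (rule R)
        show "continuous_on {0..1} (\<lambda>t. Z z t \<omega>)"
          using elim(3) inf by (auto elim: continuous_on_subset)
        show "\<bar>sqrt (2 * \<kappa>1) * B1 t \<omega>\<bar> \<le> \<sigma> * K \<and> \<bar>sqrt (2 * \<kappa>2) * B2 t \<omega>\<bar> \<le> \<sigma> * K"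
          if "t \<in> {0..1}" for t
          using elim(1) \<open>\<omega> \<in> E\<close> that assms(7,8) by (intro conjI noise) (auto simp: \<sigma>_def)
        show "Z z t \<omega> = (- R, 0) + integral {0..t}
             (\<lambda>s. (\<lambda>(x, y). (a1 * x - \<alpha>1 * x\<^sup>2 + y\<^sup>2, a2 * y - \<alpha>2 * x * y)) (Z z s \<omega>))
           + (sqrt (2 * \<kappa>1) * B1 t \<omega>, sqrt (2 * \<kappa>2) * B2 t \<omega>)" if "t \<in> {0..1}" for t
          using elim(3) inf that by (simp add: z_def)
      qed
    qed
  qed
  then have "measure M E \<le> measure M {\<omega> \<in> space M. \<tau> z \<omega> < \<infinity>}"
    using S by (rule finite_measure_mono_AE)
  then have "measure M {\<omega> \<in> space M. \<tau> z \<omega> < \<infinity>} > 0" using E by linarith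
  then show ?thesis by (intro exI[of _ "{z}"]) auto
qed

end
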